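(* Let $r,\beta$ be real or complex numbers with $\beta\neq 0$. For every $s\geq 0$ and every integer $n\ge 0$, $$B_{n+1}\left(\frac{r}{\beta}\right)-B_{n+1}\left(\frac{r}{\beta}-s\right)=(n+1)\sum_{k=0}^{n}W_{\beta,r}(n,k)\frac{(-1)^{k}\langle s\rangle_{k+1}}{\beta^{n+1-k}(k+1)}.$$
   Context: $B_n(x)$ are the Bernoulli polynomials, $\sum_{n\ge0}B_n(x)\frac{t^n}{n!}=\frac{t}{e^t-1}e^{xt}$. The $r$-Whitney numbers of the second kind $W_{\beta,r}(n,k)$ are defined by the formal power series identity $$\left(\frac{e^{\beta t}-1}{\beta}\right)^{k}e^{rt}=k!\sum_{n=0}^{\infty}W_{\beta,r}(n,k)\frac{t^{n}}{n!}.$$ The rising factorial is $\langle y\rangle_{0}=1$, $\langle y\rangle_{k}=y(y+1)\cdots(y+k-1)$ for $k\ge 1$.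
   Formalization: The exponent of β in the denominator is n−k instead of the printed n+1−k; the printed identity is off by a factor 1/β and fails, e.g., for n=0, r=0, β=2, s=1 (left side 1, right side 1/2). *)

theory Defs
  imports Complex_Main "HOL-Computational_Algebra.Computational_Algebra"
begin

text \<open>
  Both definitions read off coefficients of exponential generating functions, as formal power
  series in \<open>t = fps_X\<close>; \<open>fps_exp c\<close> is the series of $e^{ct}$.
\<close>

text \<open>
  The quotient below is exact: \<open>fps_exp 1 - 1\<close> has subdegree 1, hence divides \<open>fps_X\<close>.
\<close>

definition bernoulli_poly :: "nat \<Rightarrow> 'a::field_char_0 \<Rightarrow> 'a" where
  "bernoulli_poly n x = fact n * fps_nth (fps_X / (fps_exp 1 - 1) * fps_exp x) n"

definition r_whitney2 :: "'a::field_char_0 \<Rightarrow> 'a \<Rightarrow> nat \<Rightarrow> nat \<Rightarrow> 'a" where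
  "r_whitney2 \<beta> r n k =
     fact n / fact k * fps_nth (((fps_exp \<beta> - 1) / fps_const \<beta>) ^ k * fps_exp r) n"

lemma bernoulli_poly_egf:
  "Abs_fps (\<lambda>n. bernoulli_poly n x / fact n) = fps_X / (fps_exp 1 - 1) * fps_exp x"
  by (simp add: fps_eq_iff bernoulli_poly_def)

lemma fps_exp_quotient_exact:
  "fps_X / (fps_exp 1 - 1) * (fps_exp 1 - 1) = (fps_X :: 'a::field_char_0 fps)"
proof -
  let ?g = "fps_exp 1 - 1 :: 'a fps"
  have "subdegree ?g = 1"
    by (rule subdegreeI) auto
  moreover from this have "?g \<noteq> 0" by auto
  ultimately have "?g dvd fps_X"
    by (simp add: fps_dvd_iff)
  then show ?thesis by simp
qed

lemma r_whitney2_egf: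
  "((fps_exp \<beta> - 1) / fps_const \<beta>) ^ k * fps_exp r =
     fps_const (fact k) * Abs_fps (\<lambda>n. r_whitney2 \<beta> r n k / fact n)"
  by (simp add: fps_eq_iff r_whitney2_def)

end

theory Submission imports Defs begin

text \<open>
  With \<open>E = e\<^sup>t - 1\<close>, the binomial series for \<open>e\<^sup>-\<^sup>s\<^sup>t = (1 + E)\<^sup>-\<^sup>s\<close> gives
  \<open>1 - e\<^sup>-\<^sup>s\<^sup>t = E \<cdot> H(E)\<close>, where \<open>H\<close> has the coefficients
  \<open>(-1)\<^sup>k \<langle>s\<rangle>\<^bsub>k+1\<^esub> / (k+1)!\<close>. Hence the generating function
  \<open>t/E \<cdot> e\<^sup>x\<^sup>t (1 - e\<^sup>-\<^sup>s\<^sup>t)\<close> of \<open>B\<^sub>n(x) - B\<^sub>n(x - s)\<close> equals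
  \<open>t \<cdot> H(E) e\<^sup>x\<^sup>t\<close>, and for \<open>x = r/\<beta>\<close> the series \<open>E\<^sup>k e\<^sup>x\<^sup>t\<close> generates
  the \<open>r\<close>-Whitney numbers after the rescaling \<open>t \<mapsto> \<beta>t\<close>.
\<close>

text \<open>Substituting \<open>?E\<close> into \<open>(1 + X) b' = a b\<close> turns
  \<open>1 + X\<close> into the exponential series, which is also the derivative of
  \<open>?E\<close>. By the chain rule the composite solves \<open>y' = a y\<close> with constant
  term 1.\<close>

lemma fps_binomial_compose_exp_minus_1:
  "fps_binomial a oo (fps_exp 1 - 1) = fps_exp (a :: 'a::field_char_0)"
proof -
  let ?E = "fps_exp 1 - 1 :: 'a fps" and ?b = "fps_binomial a"
  have E0: "?E $ 0 = 0" by simp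
  have "is_unit (1 + fps_X :: 'a fps)"
    by simp
  then have "(1 + fps_X) * fps_deriv ?b = fps_const a * ?b"
    by (metis fps_binomial_deriv dvd_mult_div_cancel unit_imp_dvd)
  then have "((1 + fps_X) * fps_deriv ?b) oo ?E = (fps_const a * ?b) oo ?E"
    by simp
  then have "fps_exp 1 * (fps_deriv ?b oo ?E) = fps_const a * (?b oo ?E)"
    by (simp add: fps_compose_mult_distrib[OF E0] fps_compose_add_distrib)
  then have "fps_deriv (?b oo ?E) = fps_const a * (?b oo ?E)"
    by (simp add: fps_compose_deriv[OF E0] mult.commute)
  then show ?thesis
    by (simp add: fps_exp_unique_ODE)
qed

lemma fps_compose_mult_nth:
  fixes f g h :: "'a::idom fps"
  assumes "g $ 0 = 0"
  shows "((f oo g) * h) $ n = (\<Sum>k = 0..n. f $ k * (g ^ k * h) $ n)"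
proof -
  \<comment> \<open>\<open>g ^ k\<close> has no coefficients below \<open>k\<close>, so the bound
    \<open>i\<close> may be raised to the uniform \<open>n\<close>; this lets the two sums be
    swapped.\<close>
  have "(f oo g) $ i = (\<Sum>k = 0..n. f $ k * g ^ k $ i)" if "i \<le> n" for i
    unfolding fps_compose_nth
    by (rule sum.mono_neutral_left)
      (use that startsby_zero_power_prefix[OF assms] in \<open>auto simp: not_le\<close>)
  then have "((f oo g) * h) $ n = (\<Sum>i = 0..n. \<Sum>k = 0..n. f $ k * (g ^ k $ i * h $ (n - i)))"
    by (simp add: fps_mult_nth sum_distrib_right mult.assoc)
  also have "\<dots> = (\<Sum>k = 0..n. f $ k * (g ^ k * h) $ n)"
    by (subst sum.swap) (simp add: fps_mult_nth sum_distrib_left)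
  finally show ?thesis .
qed

text \<open>Replacing t by \<beta>t multiplies the n-th coefficient by \<open>\<beta> ^ n\<close>,
  and the k divisions by \<beta> take away \<open>\<beta> ^ k\<close>.\<close>

lemma r_whitney2_rescale:
  fixes r \<beta> :: "'a::field_char_0"
  assumes "\<beta> \<noteq> 0" and "k \<le> n"
  shows "r_whitney2 \<beta> r n k =
    fact n / fact k * \<beta> ^ (n - k) * ((fps_exp 1 - 1) ^ k * fps_exp (r / \<beta>)) $ n"
proof -
  let ?L = "fps_const \<beta> * fps_X"
  have L0: "?L $ 0 = 0" by simp
  have compose: "((fps_exp 1 - 1) ^ k * fps_exp (r / \<beta>)) oo ?L = (fps_exp \<beta> - 1) ^ k * fps_exp r"
    using assms by (simp add: fps_compose_mult_distrib[OF L0] fps_compose_power[OF L0, symmetric]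
        fps_compose_sub_distrib)
  have scale: "((fps_exp \<beta> - 1) ^ k * fps_exp r) $ n =
      \<beta> ^ n * ((fps_exp 1 - 1) ^ k * fps_exp (r / \<beta>)) $ n"
    by (simp add: fps_compose_linear flip: compose)
  have const: "((fps_exp \<beta> - 1) / fps_const \<beta>) ^ k * fps_exp r =
      fps_const (inverse \<beta> ^ k) * ((fps_exp \<beta> - 1) ^ k * fps_exp r)"
    using assms by (simp add: fps_divide_unit fps_const_inverse power_mult_distrib
        fps_const_power mult_ac)
  show ?thesis
    unfolding r_whitney2_def const fps_mult_left_const_nth scale
    using assms by (simp add: power_diff field_simps)
qed

lemma bernoulli_poly_diff:
  fixes x s :: "'a::field_char_0"
  shows "bernoulli_poly (Suc n) x - bernoulli_poly (Suc n) (x - s) =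
    fact (Suc n) * (\<Sum>k = 0..n. (- 1) ^ k * pochhammer s (Suc k) / fact (Suc k) *
      ((fps_exp 1 - 1) ^ k * fps_exp x) $ n)"
proof -
  let ?E = "fps_exp 1 - 1 :: 'a fps"
  have E0: "?E $ 0 = 0" by simp
  define H where "H = Abs_fps (\<lambda>k. (- 1) ^ k * pochhammer s (Suc k) / fact (Suc k))"
  \<comment> \<open>The coefficient of \<open>fps_binomial (- s)\<close> at \<open>Suc k\<close> is
    minus that of \<open>H\<close> at \<open>k\<close>; the constant terms 1 cancel.\<close>
  have "fps_X * H = 1 - fps_binomial (- s)"
    by (rule fps_ext)
      (auto simp: H_def gbinomial_pochhammer gr0_conv_Suc simp del: fact_Suc)
  then have "(fps_X * H) oo ?E = 1 - fps_exp (- s)"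
    by (simp add: fps_compose_sub_distrib fps_binomial_compose_exp_minus_1)
  then have EH: "?E * (H oo ?E) = 1 - fps_exp (- s)"
    by (simp add: fps_compose_mult_distrib[OF E0])
  have "fps_X / ?E * fps_exp x - fps_X / ?E * fps_exp (x - s) =
      fps_X / ?E * (1 - fps_exp (- s)) * fps_exp x"
    using fps_exp_add_mult[of x "- s"] by (simp add: algebra_simps)
  also have "\<dots> = (fps_X / ?E * ?E) * ((H oo ?E) * fps_exp x)"
    by (simp only: EH[symmetric] mult_ac)
  also have "\<dots> = fps_X * ((H oo ?E) * fps_exp x)"
    by (simp only: fps_exp_quotient_exact)
  \<comment> \<open>The factor \<open>fps_X\<close> lowers the index from \<open>Suc n\<close> to
    \<open>n\<close>.\<close>
  finally have "(fps_X / ?E * fps_exp x) $ Suc n - (fps_X / ?E * fps_exp (x - s)) $ Suc n =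
      ((H oo ?E) * fps_exp x) $ n"
    by (simp only: fps_sub_nth[symmetric] fps_X_mult_nth) simp
  then show ?thesis
    by (simp add: bernoulli_poly_def fps_compose_mult_nth[OF E0] H_def right_diff_distrib[symmetric]
        del: fact_Suc)
qed

theorem theorem7:
  fixes r \<beta> :: "'a::real_normed_field" and s :: real and n :: nat
  assumes "\<beta> \<noteq> 0" and "s \<ge> 0"
  shows "bernoulli_poly (n + 1) (r / \<beta>) - bernoulli_poly (n + 1) (r / \<beta> - of_real s) =
    of_nat (n + 1) * (\<Sum>k = 0..n. r_whitney2 \<beta> r n k *
      ((- 1) ^ k * pochhammer (of_real s) (k + 1) / (\<beta> ^ (n - k) * of_nat (k + 1))))"
proof -
  have "r_whitney2 \<beta> r n k *
      ((- 1) ^ k * pochhammer (of_real s) (k + 1) / (\<beta> ^ (n - k) * of_nat (k + 1))) =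
    fact n * ((- 1) ^ k * pochhammer (of_real s) (Suc k) / fact (Suc k) *
      ((fps_exp 1 - 1) ^ k * fps_exp (r / \<beta>)) $ n)" if "k \<le> n" for k
    \<comment> \<open>The power \<open>\<beta> ^ (n - k)\<close> from the rescaling cancels the
      denominator, and \<open>fact k\<close> times \<open>k + 1\<close> gives
      \<open>fact (Suc k)\<close>.\<close>
    using assms(1) by (simp add: r_whitney2_rescale[OF assms(1) that] mult_ac del: of_nat_Suc)
  then show ?thesis
    by (simp add: bernoulli_poly_diff sum_distrib_left mult.assoc del: of_nat_Suc)
qed

end
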